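(* Let $\mathcal{H}$ be a complex Hilbert space, let $A\in\mathcal{B}(\mathcal{H})$ be a nonzero positive operator, and let $\mathbb{A}=\begin{pmatrix}A&O\\O&A\end{pmatrix}$ on $\mathcal{H}\oplus\mathcal{H}$. Let $P,Q,R,S\in\mathcal{B}_A(\mathcal{H})$. Then $$\omega_{\mathbb{A}}\left[\begin{pmatrix}P&Q\\R&S\end{pmatrix}\right]\leq\min\{\mu,\nu\},$$ where $$\mu=\tfrac{\sqrt2}{2}\sqrt{\|P\|_A^2+\|Q\|_A^2+\sqrt{(\|P\|_A^2-\|Q\|_A^2)^2+4\|P^{\sharp_A}Q\|_A^2}}+\tfrac{\sqrt2}{2}\sqrt{\|R\|_A^2+\|S\|_A^2+\sqrt{(\|R\|_A^2-\|S\|_A^2)^2+4\|S^{\sharp_A}R\|_A^2}}$$ and $$\nu=\tfrac{\sqrt2}{2}\sqrt{\|P\|_A^2+\|R\|_A^2+\sqrt{(\|P\|_A^2-\|R\|_A^2)^2+4\|PR^{\sharp_A}\|_A^2}}+\tfrac{\sqrt2}{2}\sqrt{\|Q\|_A^2+\|S\|_A^2+\sqrt{(\|Q\|_A^2-\|S\|_A^2)^2+4\|SQ^{\sharp_A}\|_A^2}}.$$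
   Context: For a positive operator $A$ on $\mathcal{H}$, $\langle x,y\rangle_A:=\langle Ax,y\rangle$ and $\|x\|_A:=\sqrt{\langle x,x\rangle_A}$. $\mathcal{B}_A(\mathcal{H})$ is the set of $T\in\mathcal{B}(\mathcal{H})$ with $\mathcal{R}(T^*A)\subseteq\mathcal{R}(A)$; for such $T$, $T^{\sharp_A}$ is the unique solution $X$ of $AX=T^*A$ with $\mathcal{R}(X)\subseteq\overline{\mathcal{R}(A)}$. For $T$ bounded with respect to $\|\cdot\|_A$: $\|T\|_A:=\sup\{\|Tx\|_A:\|x\|_A=1\}$, $\omega_A(T):=\sup\{|\langle Tx,x\rangle_A|:\|x\|_A=1\}$. $\omega_{\mathbb{A}}$ is defined analogously on $\mathcal{H}\oplus\mathcal{H}$ with $\langle (x_1,x_2),(y_1,y_2)\rangle_{\mathbb{A}}=\langle x_1,y_1\rangle_A+\langle x_2,y_2\rangle_A$. *)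

theory Defs
  imports "HOL-Analysis.Analysis"
begin

text \<open>A complex Hilbert space is modelled as a real Hilbert space (class real_inner
with completeness) equipped with a complex structure J (multiplication by the imaginary
unit): J is real-linear, J (J x) = - x, and J preserves the real inner product.
The real inner product is then the real part of the complex inner product.\<close>

definition complex_structure :: "('a::real_inner \<Rightarrow> 'a) \<Rightarrow> bool" where
  "complex_structure J \<longleftrightarrow> linear J \<and> (\<forall>x. J (J x) = - x) \<and> (\<forall>x y. inner (J x) (J y) = inner x y)"

text \<open>Complex inner product (linear in the first, conjugate-linear in the second slot).\<close>
definition cinner :: "('a::real_inner \<Rightarrow> 'a) \<Rightarrow> 'a \<Rightarrow> 'a \<Rightarrow> complex" where
  "cinner J x y = Complex (inner x y) (inner x (J y))"

definition is_op :: "('a::real_inner \<Rightarrow> 'a) \<Rightarrow> ('a \<Rightarrow> 'a) \<Rightarrow> bool" where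
  "is_op J T \<longleftrightarrow> bounded_linear T \<and> (\<forall>x. T (J x) = J (T x))"

definition cadj :: "('a::real_inner \<Rightarrow> 'a) \<Rightarrow> ('a \<Rightarrow> 'a) \<Rightarrow> ('a \<Rightarrow> 'a)" where
  "cadj J T = (THE S. \<forall>x y. cinner J (T x) y = cinner J x (S y))"

definition positive_op :: "('a::real_inner \<Rightarrow> 'a) \<Rightarrow> ('a \<Rightarrow> 'a) \<Rightarrow> bool" where
  "positive_op J A \<longleftrightarrow> is_op J A \<and> (\<forall>x. Im (cinner J (A x) x) = 0 \<and> Re (cinner J (A x) x) \<ge> 0)"

definition cinnerA :: "('a::real_inner \<Rightarrow> 'a) \<Rightarrow> ('a \<Rightarrow> 'a) \<Rightarrow> 'a \<Rightarrow> 'a \<Rightarrow> complex" where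
  "cinnerA J A x y = cinner J (A x) y"

definition normA :: "('a::real_inner \<Rightarrow> 'a) \<Rightarrow> ('a \<Rightarrow> 'a) \<Rightarrow> 'a \<Rightarrow> real" where
  "normA J A x = sqrt (Re (cinnerA J A x x))"

definition BA :: "('a::real_inner \<Rightarrow> 'a) \<Rightarrow> ('a \<Rightarrow> 'a) \<Rightarrow> ('a \<Rightarrow> 'a) set" where
  "BA J A = {T. is_op J T \<and> range (cadj J T \<circ> A) \<subseteq> range A}"

definition sharpA :: "('a::real_inner \<Rightarrow> 'a) \<Rightarrow> ('a \<Rightarrow> 'a) \<Rightarrow> ('a \<Rightarrow> 'a) \<Rightarrow> ('a \<Rightarrow> 'a)" where
  "sharpA J A T = (THE X. is_op J X \<and> A \<circ> X = cadj J T \<circ> A \<and> range X \<subseteq> closure (range A))"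

definition opnormA :: "('a::real_inner \<Rightarrow> 'a) \<Rightarrow> ('a \<Rightarrow> 'a) \<Rightarrow> ('a \<Rightarrow> 'a) \<Rightarrow> real" where
  "opnormA J A T = (SUP x\<in>{x. normA J A x = 1}. normA J A (T x))"

definition numradA :: "('a::real_inner \<Rightarrow> 'a) \<Rightarrow> ('a \<Rightarrow> 'a) \<Rightarrow> ('a \<Rightarrow> 'a) \<Rightarrow> real" where
  "numradA J A T = (SUP x\<in>{x. normA J A x = 1}. cmod (cinnerA J A (T x) x))"

text \<open>Direct sum H (+) H as the product type, with the componentwise complex structure;
the real inner product on pairs is the sum of the component inner products.\<close>
definition Jsum :: "('a \<Rightarrow> 'a) \<Rightarrow> ('a \<times> 'a \<Rightarrow> 'a \<times> 'a)" where
  "Jsum J = (\<lambda>(x, y). (J x, J y))"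

definition blk :: "('a::real_vector \<Rightarrow> 'a) \<Rightarrow> ('a \<Rightarrow> 'a) \<Rightarrow> ('a \<Rightarrow> 'a) \<Rightarrow> ('a \<Rightarrow> 'a) \<Rightarrow> ('a \<times> 'a \<Rightarrow> 'a \<times> 'a)" where
  "blk P Q R S = (\<lambda>(x, y). (P x + Q y, R x + S y))"

end

theory Submission
  imports Defs
begin

text \<open>For a unit vector \<open>(x, y)\<close>, Cauchy-Schwarz bounds the modulus of the quadratic form of the block
operator by \<open>\<parallel>Px + Qy\<parallel>\<^sub>A + \<parallel>Rx + Sy\<parallel>\<^sub>A\<close>. Expanding \<open>\<parallel>Px + Qy\<parallel>\<^sub>A\<^sup>2\<close> and moving \<open>P\<close> across the
semi-inner product gives a quadratic form in \<open>(\<parallel>x\<parallel>\<^sub>A, \<parallel>y\<parallel>\<^sub>A)\<close> with diagonal \<open>\<parallel>P\<parallel>\<^sub>A\<^sup>2, \<parallel>Q\<parallel>\<^sub>A\<^sup>2\<close> and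
off-diagonal entry the seminorm of \<open>P\<^sup>\<sharp> Q\<close>, whose largest eigenvalue is the radicand in \<open>\<mu>\<close>; the same
argument for the adjoint block operator gives \<open>\<nu>\<close>. The analytic content is that the distinguished
adjoint exists as a bounded operator (Riesz, projection and Baire) and that an operator having one is
bounded for the seminorm, so that the suprema are genuine.\<close>

section \<open>Riesz representation and adjoints\<close>

text \<open>Working on a closed subspace lets one lemma serve twice: \<open>M = UNIV\<close> yields
  adjoints, and the functional \<open>inner x\<close> yields the orthogonal projection of
  \<open>x\<close> onto \<open>M\<close>.\<close>

lemma riesz_representation_on_subspace:
  fixes M :: "'a::{real_inner, complete_space} set" and f :: "'a \<Rightarrow> real"
  assumes M: "subspace M" "closed M" and f: "bounded_linear f"
  obtains p where "p \<in> M" "\<And>m. m \<in> M \<Longrightarrow> f m = inner p m"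
proof -
  \<comment> \<open>The representing vector minimises \<^term>\<open>\<phi>\<close>, which is uniformly convex.\<close>
  define \<phi> where "\<phi> m = inner m m - 2 * f m" for m
  interpret f: bounded_linear f by (rule f)
  obtain K where K: "\<And>x. \<bar>f x\<bar> \<le> norm x * K"
    using f.bounded by auto
  have lower: "- K\<^sup>2 \<le> \<phi> m" for m
  proof -
    have "f m \<le> norm m * K"
      using K[of m] by linarith
    moreover have "0 \<le> (norm m - K)\<^sup>2"
      by simp
    ultimately show ?thesis
      by (simp add: \<phi>_def power2_norm_eq_inner[symmetric] power2_diff)
  qed
  define d where "d = Inf (\<phi> ` M)"
  have bdd: "bdd_below (\<phi> ` M)"
    using lower by (auto intro!: bdd_belowI)
  have ne: "\<phi> ` M \<noteq> {}"
    using subspace_0[OF M(1)] by blast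
  have d_le: "d \<le> \<phi> m" if "m \<in> M" for m
    unfolding d_def using that bdd by (auto intro: cInf_lower)
  have "\<exists>m\<in>M. \<phi> m < d + 1 / (real n + 1)" for n
    using cInf_lessD[OF ne, of "d + 1 / (real n + 1)"] unfolding d_def by auto
  then obtain u where u: "\<And>n. u n \<in> M" "\<And>n. \<phi> (u n) < d + 1 / (real n + 1)"
    by metis
  \<comment> \<open>The linear part of \<open>\<phi>\<close> cancels in this combination.
    Near-minimisers are therefore close together, since their midpoint stays in \<open>M\<close> and
    has value at least \<open>d\<close>.\<close>
  have parallelogram: "(norm (x - y))\<^sup>2 = 2 * \<phi> x + 2 * \<phi> y - 4 * \<phi> ((1/2) *\<^sub>R (x + y))" for x y
    by (simp add: \<phi>_def power2_norm_eq_inner f.scaleR f.add inner_add_left inner_add_right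
        inner_diff_left inner_diff_right inner_commute field_simps)
  have near: "(norm (u m - u n))\<^sup>2 < 4 / (real N + 1)" if "N \<le> m" "N \<le> n" for m n N
  proof -
    have "(1/2) *\<^sub>R (u m + u n) \<in> M"
      using u(1) M(1) by (simp add: subspace_add subspace_scale)
    then have "d \<le> \<phi> ((1/2) *\<^sub>R (u m + u n))"
      by (rule d_le)
    moreover have "1 / (real m + 1) \<le> 1 / (real N + 1)" "1 / (real n + 1) \<le> 1 / (real N + 1)"
      using that by (auto simp: field_simps)
    ultimately show ?thesis
      using u(2)[of m] u(2)[of n] parallelogram[of "u m" "u n"] by simp
  qed
  have "Cauchy u"
  proof (rule metric_CauchyI)
    fix e :: real assume e: "e > 0"
    obtain N :: nat where N: "4 / e\<^sup>2 < real N"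
      using reals_Archimedean2 by blast
    then have "4 < (real N + 1) * e\<^sup>2"
      using e by (simp add: field_simps add_strict_increasing)
    then have "4 / (real N + 1) < e\<^sup>2"
      by (simp add: field_simps)
    then have "(norm (u m - u n))\<^sup>2 < e\<^sup>2" if "N \<le> m" "N \<le> n" for m n
      using near[OF that] by linarith
    then have "dist (u m) (u n) < e" if "N \<le> m" "N \<le> n" for m n
      using that e unfolding dist_norm by (meson power2_less_imp_less less_imp_le)
    then show "\<exists>N. \<forall>m\<ge>N. \<forall>n\<ge>N. dist (u m) (u n) < e"
      by blast
  qed
  then obtain p where p: "u \<longlonglongrightarrow> p"
    by (auto simp: Cauchy_convergent_iff convergent_def)
  have pM: "p \<in> M"
    using closed_sequentially[OF M(2)] u(1) p by blast
  have "(\<lambda>n. \<phi> (u n)) \<longlonglongrightarrow> \<phi> p"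
    unfolding \<phi>_def by (intro tendsto_intros p f.tendsto)
  moreover have "(\<lambda>n. d + 1 / (real n + 1)) \<longlonglongrightarrow> d + 0"
    by (intro tendsto_add tendsto_const) (use LIMSEQ_inverse_real_of_nat in \<open>simp add: inverse_eq_divide add.commute\<close>)
  ultimately have p_min: "\<phi> p \<le> d"
    using LIMSEQ_le u(2) by (metis (no_types, lifting) add.right_neutral less_imp_le)
  have "f m = inner p m" if m: "m \<in> M" for m
  proof -
    define g where "g = inner p m - f m"
    have var: "0 \<le> 2 * t * g + t\<^sup>2 * inner m m" for t
    proof -
      have "p + t *\<^sub>R m \<in> M"
        using pM m M(1) by (simp add: subspace_add subspace_scale)
      from d_le[OF this] p_min have "\<phi> p \<le> \<phi> (p + t *\<^sub>R m)"
        by linarith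
      then show ?thesis
        by (simp add: \<phi>_def g_def f.add f.scaleR inner_add_left inner_add_right inner_commute
            algebra_simps power2_eq_square)
    qed
    have "g = 0"
    proof (rule ccontr)
      assume "g \<noteq> 0"
      \<comment> \<open>The variation inequality is tested at \<open>t = - g / c\<close>; the
        summand 1 keeps \<open>c\<close> positive when \<open>m = 0\<close>.\<close>
      define c where "c = inner m m + 1"
      have c: "c > 0" "inner m m \<le> c"
        by (auto simp: c_def add_nonneg_pos)
      have "0 \<le> 2 * (- g / c) * g + (- g / c)\<^sup>2 * inner m m"
        by (rule var)
      also have "\<dots> \<le> 2 * (- g / c) * g + (- g / c)\<^sup>2 * c"
        using c by (intro add_left_mono mult_left_mono) auto
      also have "\<dots> = - (g\<^sup>2 / c)"
        using c by (simp add: field_simps power2_eq_square)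
      also have "\<dots> < 0"
        using c \<open>g \<noteq> 0\<close> by simp
      finally show False by simp
    qed
    then show ?thesis by (simp add: g_def)
  qed
  with pM that show thesis by blast
qed

lemma real_adjoint_exists:
  fixes T :: "'a::{real_inner, complete_space} \<Rightarrow> 'a"
  assumes "bounded_linear T"
  obtains S where "\<And>x y. inner (T x) y = inner x (S y)"
proof -
  have "\<exists>s. \<forall>x. inner (T x) y = inner x s" for y
  proof -
    have "bounded_linear (\<lambda>x. inner (T x) y)"
      by (intro bounded_linear_compose[OF bounded_linear_inner_left] assms)
    then obtain s where "\<And>x. x \<in> UNIV \<Longrightarrow> inner (T x) y = inner s x"
      using riesz_representation_on_subspace[of UNIV "\<lambda>x. inner (T x) y"] by auto
    then show ?thesis by (metis UNIV_I inner_commute)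
  qed
  then show thesis using that by metis
qed

lemma orthogonal_decomposition:
  fixes M :: "'a::{real_inner, complete_space} set"
  assumes "subspace M" "closed M"
  obtains p where "p \<in> M" "\<And>m. m \<in> M \<Longrightarrow> inner (x - p) m = 0"
proof -
  obtain p where "p \<in> M" "\<And>m. m \<in> M \<Longrightarrow> inner x m = inner p m"
    using riesz_representation_on_subspace[OF assms bounded_linear_inner_right[of x]] by metis
  with that show thesis by (simp add: inner_diff_left)
qed

section \<open>Closures of subspaces, and boundedness from closed sublevel sets\<close>

lemma subspace_closure:
  fixes S :: "'a::real_normed_vector set"
  assumes S: "subspace S"
  shows "subspace (closure S)"
proof (rule subspaceI)
  show "0 \<in> closure S"
    using S closure_subset subspace_0 by blast
next
  fix x y assume "x \<in> closure S" "y \<in> closure S"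
  then obtain f g where "\<forall>n. f n \<in> S" "f \<longlonglongrightarrow> x" "\<forall>n. g n \<in> S" "g \<longlonglongrightarrow> y"
    unfolding closure_sequential by blast
  then have "(\<forall>n. f n + g n \<in> S) \<and> (\<lambda>n. f n + g n) \<longlonglongrightarrow> x + y"
    by (simp add: S subspace_add tendsto_add)
  then show "x + y \<in> closure S"
    unfolding closure_sequential by (intro exI)
next
  fix c x assume "x \<in> closure S"
  then obtain f where "\<forall>n. f n \<in> S" "f \<longlonglongrightarrow> x"
    unfolding closure_sequential by blast
  then have "(\<forall>n. c *\<^sub>R f n \<in> S) \<and> (\<lambda>n. c *\<^sub>R f n) \<longlonglongrightarrow> c *\<^sub>R x"
    by (simp add: S subspace_scale tendsto_scaleR)
  then show "c *\<^sub>R x \<in> closure S"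
    unfolding closure_sequential by (intro exI)
qed

text \<open>By Baire some sublevel set contains a ball; linearity moves the ball to the origin.\<close>

lemma bounded_linear_if_closed_sublevel:
  fixes f :: "'a::{real_normed_vector, complete_space} \<Rightarrow> 'b::real_normed_vector"
  assumes f: "linear f" and closed: "\<And>n::nat. closed {x. norm (f x) \<le> real n}"
  shows "bounded_linear f"
proof -
  have "\<exists>n::nat. interior {x. norm (f x) \<le> real n} \<noteq> {}"
  proof (rule ccontr)
    assume "\<nexists>n::nat. interior {x. norm (f x) \<le> real n} \<noteq> {}"
    then have "euclidean interior_of \<Union>(range (\<lambda>n. {x. norm (f x) \<le> real n})) = {}"
      by (intro Baire_category_alt)
        (use closed in \<open>auto simp: completely_metrizable_space_euclidean\<close>)
    moreover have "\<Union>(range (\<lambda>n. {x. norm (f x) \<le> real n})) = UNIV"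
      using real_arch_simple by auto
    ultimately show False by simp
  qed
  then obtain n :: nat and a where "a \<in> interior {x. norm (f x) \<le> real n}"
    by blast
  then obtain e where e: "e > 0" "cball a e \<subseteq> {x. norm (f x) \<le> real n}"
    unfolding mem_interior_cball by blast
  have "norm (f x) \<le> norm x * (2 * real n / e)" for x
  proof (cases "x = 0")
    case True
    then show ?thesis by (simp add: linear_0[OF f])
  next
    case False
    define s where "s = e / norm x"
    have s: "s > 0" using False e by (simp add: s_def)
    have "a + s *\<^sub>R x \<in> cball a e" "a \<in> cball a e"
      using e False by (auto simp: s_def dist_norm)
    then have bnd: "norm (f (a + s *\<^sub>R x)) \<le> real n" "norm (f a) \<le> real n"
      using e(2) by blast+
    have "s *\<^sub>R f x = f (a + s *\<^sub>R x) - f a"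
      by (simp add: linear_add[OF f] linear_scale[OF f])
    then have "s * norm (f x) = norm (f (a + s *\<^sub>R x) - f a)"
      using s by (metis abs_of_pos norm_scaleR)
    also have "\<dots> \<le> 2 * real n"
      using norm_triangle_ineq4[of "f (a + s *\<^sub>R x)" "f a"] bnd by linarith
    finally show ?thesis
      using False e by (simp add: s_def field_simps)
  qed
  with f show ?thesis
    by (intro bounded_linear_intro[where K = "2 * real n / e"]) (auto simp: linear_add linear_scale)
qed

section \<open>The semi-inner product of a positive operator\<close>

text \<open>Evaluate at the minimiser \<open>t = - b / c\<close>. The affine case
  \<open>c = 0\<close> arises from null vectors of the semi-inner product.\<close>

lemma discriminant_le_if_quadratic_nonneg:
  fixes a b c :: real
  assumes q: "\<And>t. 0 \<le> a + 2 * t * b + t\<^sup>2 * c" and c: "0 \<le> c"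
  shows "b\<^sup>2 \<le> a * c"
proof (cases "c = 0")
  case True
  have "b = 0"
  proof (rule ccontr)
    assume "b \<noteq> 0"
    \<comment> \<open>The chosen \<open>t\<close> gives the affine function the value -1.\<close>
    then show False
      using q[of "- (a + 1) / (2 * b)"] True by (simp add: field_simps)
  qed
  then show ?thesis by (simp add: True)
next
  case False
  then show ?thesis
    using q[of "- b / c"] c by (simp add: field_simps power2_eq_square)
qed

locale semi_hilbert =
  fixes J A :: "'h::{real_inner, complete_space} \<Rightarrow> 'h"
  assumes J: "complex_structure J" and A: "positive_op J A"
begin

text \<open>This is the real part of \<open>cinnerA J A x y\<close>; the imaginary part is
  \<open>ipA x (J y)\<close>, so estimates can be carried out over the reals.\<close>

definition ipA :: "'h \<Rightarrow> 'h \<Rightarrow> real" where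
  "ipA x y = inner (A x) y"

abbreviation nA :: "'h \<Rightarrow> real" where
  "nA \<equiv> normA J A"

lemma linear_J: "linear J" and J_J [simp]: "J (J x) = - x"
  and inner_J_J [simp]: "inner (J x) (J y) = inner x y"
  using J unfolding complex_structure_def by blast+

lemma inner_J_right: "inner x (J y) = - inner (J x) y"
  using inner_J_J[of "J x" y] by simp

lemma bounded_linear_J: "bounded_linear J"
proof (rule bounded_linear_intro[where K = 1])
  show "norm (J x) \<le> norm x * 1" for x
    by (simp add: norm_eq_sqrt_inner)
qed (simp_all add: linear_add[OF linear_J] linear_scale[OF linear_J])

lemma bounded_linear_A: "bounded_linear A" and A_J: "A (J x) = J (A x)"
  and A_nonneg: "0 \<le> inner (A x) x" and inner_A_J_self: "inner (A x) (J x) = 0"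
  using A unfolding positive_op_def is_op_def cinner_def by auto

lemmas linear_A = bounded_linear.linear[OF bounded_linear_A]

text \<open>Over the complex numbers positivity alone forces symmetry: polarise the vanishing imaginary part.\<close>

lemma A_symmetric: "inner (A x) y = inner x (A y)"
proof -
  have "inner (A (x + J y)) (J (x + J y)) = 0"
    by (rule inner_A_J_self)
  then have "inner (A x) (J (J y)) + inner (A (J y)) (J x) = 0"
    using inner_A_J_self[of x] inner_A_J_self[of "J y"]
    by (simp add: linear_add[OF linear_A] linear_add[OF linear_J] inner_add_left inner_add_right
        inner_diff_right)
  then show ?thesis
    by (simp add: A_J inner_commute)
qed

lemma ipA_commute: "ipA x y = ipA y x"
  unfolding ipA_def by (metis A_symmetric inner_commute)

lemma ipA_add_left: "ipA (x + y) z = ipA x z + ipA y z"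
  and ipA_add_right: "ipA z (x + y) = ipA z x + ipA z y"
  and ipA_scaleR_left: "ipA (c *\<^sub>R x) z = c * ipA x z"
  and ipA_scaleR_right: "ipA z (c *\<^sub>R x) = c * ipA z x"
  by (simp_all add: ipA_def linear_add[OF linear_A] linear_scale[OF linear_A]
      inner_add_left inner_add_right)

lemma ipA_J_J: "ipA (J x) (J y) = ipA x y"
  and ipA_J_self: "ipA x (J x) = 0"
  by (simp_all add: ipA_def A_J inner_A_J_self)

lemma nA_eq: "nA x = sqrt (ipA x x)"
  by (simp add: normA_def cinnerA_def cinner_def ipA_def)

lemma ipA_self_nonneg: "0 \<le> ipA x x"
  by (simp add: ipA_def A_nonneg)

lemma nA_nonneg [simp]: "0 \<le> nA x"
  by (simp add: nA_eq ipA_self_nonneg)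

lemma nA_power2: "(nA x)\<^sup>2 = ipA x x"
  by (simp add: nA_eq ipA_self_nonneg)

lemma nA_scaleR: "nA (c *\<^sub>R x) = \<bar>c\<bar> * nA x"
  by (simp add: nA_eq ipA_scaleR_left ipA_scaleR_right real_sqrt_mult mult.assoc[symmetric])

lemma ipA_Cauchy_Schwarz: "\<bar>ipA x y\<bar> \<le> nA x * nA y"
proof -
  have "0 \<le> ipA x x + 2 * t * ipA x y + t\<^sup>2 * ipA y y" for t
    using ipA_self_nonneg[of "x + t *\<^sub>R y"]
    by (simp add: ipA_add_left ipA_add_right ipA_scaleR_left ipA_scaleR_right
        ipA_commute[of y x] power2_eq_square algebra_simps)
  then have "(ipA x y)\<^sup>2 \<le> ipA x x * ipA y y"
    by (rule discriminant_le_if_quadratic_nonneg) (rule ipA_self_nonneg)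
  also have "\<dots> = (nA x * nA y)\<^sup>2"
    by (simp add: power_mult_distrib nA_power2)
  finally show ?thesis
    by (metis abs_le_square_iff abs_of_nonneg mult_nonneg_nonneg nA_nonneg)
qed

lemma cinnerA_eq: "cinnerA J A x y = Complex (ipA x y) (ipA x (J y))"
  by (simp add: cinnerA_def cinner_def ipA_def)

lemma cinnerA_Cauchy_Schwarz: "cmod (cinnerA J A x y) \<le> nA x * nA y"
proof -
  define a b where "a = ipA x y" and "b = ipA x (J y)"
  \<comment> \<open>\<open>z\<close> is \<open>y\<close> multiplied by the complex number
    \<open>cinnerA J A x y\<close>. Then \<open>ipA x z\<close> is the squared modulus of that
    number, and the real Cauchy-Schwarz inequality suffices.\<close>
  define z where "z = a *\<^sub>R y + b *\<^sub>R J y"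
  define r where "r = cmod (cinnerA J A x y)"
  have r2: "r\<^sup>2 = a\<^sup>2 + b\<^sup>2" and r: "0 \<le> r"
    by (simp_all add: r_def cinnerA_eq a_def b_def cmod_power2)
  have "ipA z z = (a\<^sup>2 + b\<^sup>2) * ipA y y"
    by (simp add: z_def ipA_add_left ipA_add_right ipA_scaleR_left ipA_scaleR_right ipA_J_J
        ipA_J_self ipA_commute[of "J y" y] power2_eq_square algebra_simps)
  then have z: "nA z = r * nA y"
    by (simp add: nA_eq real_sqrt_mult r flip: r2)
  have "r\<^sup>2 = ipA x z"
    unfolding r2 by (simp add: z_def ipA_add_right ipA_scaleR_right power2_eq_square flip: a_def b_def)
  also have "\<dots> \<le> nA x * (r * nA y)"
    using ipA_Cauchy_Schwarz[of x z] by (simp add: z)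
  finally have "r * r \<le> r * (nA x * nA y)"
    by (simp add: power2_eq_square algebra_simps)
  then show ?thesis
    unfolding r_def[symmetric] using r
    by (cases "r = 0") (auto simp: mult_le_cancel_left)
qed

section \<open>Operators with an adjoint for the semi-inner product\<close>

text \<open>Unlike the distinguished adjoint, this relation is symmetric and compatible with
  composition, so bounds transfer to adjoints and to products such as
  \<open>sharpA J A P \<circ> Q\<close>.\<close>

definition adjoint_pair :: "('h \<Rightarrow> 'h) \<Rightarrow> ('h \<Rightarrow> 'h) \<Rightarrow> bool" where
  "adjoint_pair T X \<longleftrightarrow> bounded_linear T \<and> bounded_linear X \<and> (\<forall>x y. ipA (T x) y = ipA x (X y))"

lemma adjoint_pair_sym: "adjoint_pair T X \<Longrightarrow> adjoint_pair X T"
  unfolding adjoint_pair_def by (metis ipA_commute)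

lemma adjoint_pair_comp:
  "adjoint_pair T X \<Longrightarrow> adjoint_pair U Y \<Longrightarrow> adjoint_pair (T \<circ> U) (Y \<circ> X)"
  unfolding adjoint_pair_def by (simp add: bounded_linear_compose o_def)

text \<open>The sequence of seminorms of \<open>M\<^sup>k x\<close> is log-convex, so its first ratio is at most its growth
rate, which boundedness of \<^term>\<open>M\<close> in the Hilbert norm controls.\<close>

lemma symmetric_imp_nA_bounded:
  assumes M: "adjoint_pair M M"
  obtains K where "0 \<le> K" "\<And>x. nA (M x) \<le> K * nA x"
proof -
  have bM: "bounded_linear M" and sym: "\<And>x y. ipA (M x) y = ipA x (M y)"
    using M unfolding adjoint_pair_def by auto
  obtain K where K: "0 < K" "\<And>x. norm (M x) \<le> norm x * K"
    using bounded_linear.pos_bounded[OF bM] by blast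
  obtain C where C: "0 < C" "\<And>x. norm (A x) \<le> norm x * C"
    using bounded_linear.pos_bounded[OF bounded_linear_A] by blast
  have nA_le: "nA x \<le> sqrt C * norm x" for x
  proof -
    have "ipA x x \<le> norm (A x) * norm x"
      unfolding ipA_def by (rule norm_cauchy_schwarz)
    also have "\<dots> \<le> C * (norm x)\<^sup>2"
      using mult_right_mono[OF C(2)[of x], of "norm x"] by (simp add: power2_eq_square algebra_simps)
    finally show ?thesis
      using real_sqrt_le_mono[of "ipA x x" "C * (norm x)\<^sup>2"] by (simp add: nA_eq real_sqrt_mult)
  qed
  \<comment> \<open>The Hilbert-norm bound \<open>K\<close> itself serves as the seminorm bound.
    Null vectors are treated apart because the ratio \<open>r\<close> divides by
    \<open>nA x\<close>.\<close>
  have "nA (M x) \<le> K * nA x" for x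
  proof (cases "nA x = 0")
    case True
    have "(nA (M x))\<^sup>2 = ipA x (M (M x))"
      by (simp add: nA_power2 sym)
    also have "\<dots> \<le> 0"
      using ipA_Cauchy_Schwarz[of x "M (M x)"] True by simp
    finally show ?thesis by (simp add: True)
  next
    case False
    define a where "a k = nA ((M ^^ k) x)" for k
    have a_nonneg: "0 \<le> a k" for k by (simp add: a_def)
    have a0: "0 < a 0" using False by (simp add: a_def less_le)
    have logconvex: "a (Suc k) * a (Suc k) \<le> a k * a (Suc (Suc k))" for k
    proof -
      have "(a (Suc k))\<^sup>2 = ipA ((M ^^ k) x) ((M ^^ Suc (Suc k)) x)"
        by (simp add: a_def nA_power2 sym)
      also have "\<dots> \<le> a k * a (Suc (Suc k))"
        using ipA_Cauchy_Schwarz[of "(M ^^ k) x" "(M ^^ Suc (Suc k)) x"] by (simp add: a_def)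
      finally show ?thesis by (simp add: power2_eq_square)
    qed
    \<comment> \<open>Log-convexity makes successive ratios nondecreasing; the cross-multiplied form
      also covers vanishing terms.\<close>
    have ratio: "a 1 * a k \<le> a 0 * a (Suc k)" for k
    proof (induction k)
      case (Suc k)
      show ?case
      proof (cases "a (Suc k) = 0")
        case True
        then show ?thesis using a_nonneg by simp
      next
        case False
        have "a 1 * (a (Suc k) * a (Suc k)) \<le> a 1 * (a k * a (Suc (Suc k)))"
          by (intro mult_left_mono logconvex a_nonneg)
        also have "\<dots> \<le> (a 0 * a (Suc k)) * a (Suc (Suc k))"
          using mult_right_mono[OF Suc a_nonneg[of "Suc (Suc k)"]] by (simp add: mult.assoc)
        finally have "a (Suc k) * (a 1 * a (Suc k)) \<le> a (Suc k) * (a 0 * a (Suc (Suc k)))"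
          by (simp add: algebra_simps)
        then show ?thesis
          using False a_nonneg[of "Suc k"] by (simp add: mult_le_cancel_left)
      qed
    qed simp
    define r where "r = a 1 / a 0"
    have r: "0 \<le> r" using a0 a_nonneg by (simp add: r_def)
    have lower: "r ^ k * a 0 \<le> a k" for k
    proof (induction k)
      case (Suc k)
      have "r ^ Suc k * a 0 \<le> r * a k"
        using mult_left_mono[OF Suc r] by (simp add: mult.assoc)
      also have "\<dots> \<le> a (Suc k)"
        using ratio[of k] a0 by (simp add: r_def field_simps)
      finally show ?case .
    qed simp
    have pow: "norm ((M ^^ k) x) \<le> K ^ k * norm x" for k
    proof (induction k)
      case (Suc k)
      have "norm ((M ^^ Suc k) x) \<le> norm ((M ^^ k) x) * K"
        using K(2) by simp
      also have "\<dots> \<le> (K ^ k * norm x) * K"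
        using Suc K(1) by (intro mult_right_mono) auto
      finally show ?case by (simp add: algebra_simps)
    qed simp
    have upper: "a k \<le> (sqrt C * norm x) * K ^ k" for k
    proof -
      have "a k \<le> sqrt C * norm ((M ^^ k) x)"
        unfolding a_def by (rule nA_le)
      also have "\<dots> \<le> sqrt C * (K ^ k * norm x)"
        using C(1) by (intro mult_left_mono pow) simp
      finally show ?thesis by (simp add: algebra_simps)
    qed
    \<comment> \<open>For every \<open>k\<close>, \<open>r ^ k * a 0\<close> is at most a constant
      times \<open>K ^ k\<close>, which fails for large \<open>k\<close> if \<open>r\<close> exceeds
      \<open>K\<close>.\<close>
    have "r \<le> K"
    proof (rule ccontr)
      assume "\<not> r \<le> K"
      then have "1 < r / K" using K(1) by simp
      then obtain k where k: "sqrt C * norm x / a 0 < (r / K) ^ k"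
        using real_arch_pow by blast
      then have "sqrt C * norm x * K ^ k < r ^ k * a 0"
        using a0 K(1) by (simp add: field_simps power_divide)
      then show False
        using lower[of k] upper[of k] by linarith
    qed
    then show ?thesis
      using a0 by (simp add: r_def a_def field_simps)
  qed
  with that K(1) show thesis by (meson less_imp_le)
qed

text \<open>\<open>X \<circ> T\<close> is symmetric, hence bounded by some \<open>K\<close>, and the
  squared seminorm of \<open>T x\<close> is \<open>ipA x (X (T x))\<close>; this gives the bound
  \<open>sqrt K\<close>.\<close>

lemma adjoint_pair_imp_nA_bounded:
  assumes T: "adjoint_pair T X"
  obtains K where "0 \<le> K" "\<And>x. nA (T x) \<le> K * nA x"
proof -
  have "adjoint_pair (X \<circ> T) (X \<circ> T)"
    using adjoint_pair_comp[OF adjoint_pair_sym[OF T] T] .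
  then obtain K where K: "0 \<le> K" "\<And>x. nA ((X \<circ> T) x) \<le> K * nA x"
    using symmetric_imp_nA_bounded by blast
  have "nA (T x) \<le> sqrt K * nA x" for x
  proof -
    have "(nA (T x))\<^sup>2 = ipA x (X (T x))"
      using T by (simp add: nA_power2 adjoint_pair_def)
    also have "\<dots> \<le> nA x * nA (X (T x))"
      using ipA_Cauchy_Schwarz[of x "X (T x)"] by simp
    also have "\<dots> \<le> nA x * (K * nA x)"
      using K(2)[of x] by (intro mult_left_mono) auto
    also have "\<dots> = (sqrt K * nA x)\<^sup>2"
      using K(1) by (simp add: power_mult_distrib) (simp add: power2_eq_square)
    finally show ?thesis
      by (rule power2_le_imp_le) (simp add: K(1))
  qed
  with that K(1) show thesis by (meson real_sqrt_ge_zero)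
qed

text \<open>The preceding bound makes the supremum in \<open>opnormA\<close> a genuine one. It also
  handles null vectors, which cannot be normalised: \<open>T\<close> sends them to null
  vectors.\<close>

lemma nA_le_opnormA:
  assumes T: "adjoint_pair T X"
  shows "nA (T x) \<le> opnormA J A T * nA x"
proof -
  obtain K where K: "\<And>x. nA (T x) \<le> K * nA x"
    using adjoint_pair_imp_nA_bounded[OF T] by blast
  show ?thesis
  proof (cases "nA x = 0")
    case True
    then show ?thesis using K[of x] by simp
  next
    case False
    then have pos: "0 < nA x" by (simp add: less_le)
    define y where "y = (1 / nA x) *\<^sub>R x"
    have y: "nA y = 1" using pos by (simp add: y_def nA_scaleR)
    have "bdd_above ((\<lambda>x. nA (T x)) ` {x. nA x = 1})"
      by (intro bdd_aboveI2[where M = K]) (metis K mem_Collect_eq mult.right_neutral)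
    then have "nA (T y) \<le> opnormA J A T"
      unfolding opnormA_def using y by (intro cSUP_upper) auto
    moreover have "T y = (1 / nA x) *\<^sub>R T x"
      using T by (simp add: y_def adjoint_pair_def linear_scale bounded_linear.linear)
    ultimately show ?thesis
      using pos by (simp add: nA_scaleR field_simps)
  qed
qed

text \<open>Moving \<open>X\<close> across the form and cancelling one factor
  \<open>nA (X x)\<close> bounds the adjoint by the norm of \<open>T\<close>. Hence
  \<open>\<nu>\<close> can be written with the norms of the original entries.\<close>

lemma nA_adjoint_le_opnormA:
  assumes T: "adjoint_pair T X"
  shows "nA (X x) \<le> opnormA J A T * nA x"
proof (cases "nA (X x) = 0")
  case True
  have "0 \<le> opnormA J A T * nA x"
    using nA_le_opnormA[OF T, of x] nA_nonneg[of "T x"] by linarith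
  then show ?thesis by (simp add: True)
next
  case False
  have "nA (X x) * nA (X x) = ipA x (T (X x))"
    using T adjoint_pair_sym[OF T] by (simp add: nA_power2 adjoint_pair_def flip: power2_eq_square)
  also have "\<dots> \<le> nA x * nA (T (X x))"
    using ipA_Cauchy_Schwarz[of x "T (X x)"] by simp
  also have "\<dots> \<le> nA x * (opnormA J A T * nA (X x))"
    by (intro mult_left_mono nA_le_opnormA[OF T]) simp
  finally have "nA (X x) * nA (X x) \<le> nA (X x) * (opnormA J A T * nA x)"
    by (simp add: algebra_simps)
  then show ?thesis
    using False nA_nonneg[of "X x"] by (simp add: mult_le_cancel_left)
qed

section \<open>The distinguished adjoint\<close>

text \<open>The real adjoint satisfies the complex equation because \<open>T\<close> commutes with
  \<open>J\<close>; the real part alone gives the uniqueness demanded by \<open>THE\<close>.\<close>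

lemma cadj_adjoint:
  assumes T: "is_op J T"
  shows "inner (T x) y = inner x (cadj J T y)"
proof -
  have bT: "bounded_linear T" and TJ: "\<And>x. T (J x) = J (T x)"
    using T unfolding is_op_def by auto
  obtain S where S: "\<And>x y. inner (T x) y = inner x (S y)"
    using real_adjoint_exists[OF bT] by blast
  have "cadj J T = S"
    unfolding cadj_def
  proof (rule the_equality)
    show "\<forall>x y. cinner J (T x) y = cinner J x (S y)"
      by (simp add: cinner_def S inner_J_right TJ[symmetric])
    show "S' = S" if "\<forall>x y. cinner J (T x) y = cinner J x (S' y)" for S'
    proof
      show "S' y = S y" for y
        using that by (intro vector_eq_ldot[THEN iffD1]) (simp add: cinner_def S)
    qed
  qed
  then show ?thesis by (simp add: S)
qed

lemma subspace_closure_range_A: "subspace (closure (range A))"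
  by (intro subspace_closure linear_subspace_image linear_A subspace_UNIV)

lemma eq_if_same_inner_on_range_A:
  assumes "y \<in> closure (range A)" "z \<in> closure (range A)"
    and eq: "\<And>w. inner y (A w) = inner z (A w)"
  shows "y = z"
proof -
  have "closure (range A) \<subseteq> {m. inner (y - z) m = 0}"
    using eq by (intro closure_minimal closed_hyperplane) (auto simp: inner_diff_left)
  moreover have "y - z \<in> closure (range A)"
    using assms subspace_closure_range_A by (simp add: subspace_diff)
  ultimately show ?thesis by auto
qed

text \<open>The inequality is a closed condition on the test vector, so it extends to the closure
  and may be tested at \<open>y\<close> itself.\<close>

lemma norm_le_if_inner_le_on_range_A:
  assumes y: "y \<in> closure (range A)" and n: "0 \<le> n"
    and le: "\<And>w. inner y (A w) \<le> n * norm (A w)"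
  shows "norm y \<le> n"
proof -
  have "closed {m. inner y m \<le> n * norm m}"
    by (intro closed_Collect_le continuous_intros)
  then have "closure (range A) \<subseteq> {m. inner y m \<le> n * norm m}"
    using le by (intro closure_minimal) auto
  with y have "norm y * norm y \<le> norm y * n"
    by (auto simp: power2_norm_eq_inner power2_eq_square mult.commute simp flip: power2_norm_eq_inner)
  then show ?thesis
    using n by (cases "norm y = 0") (auto simp: mult_le_cancel_left)
qed

text \<open>The sublevel sets of the norm of \<open>X\<close> are closed because that norm is determined by the pairings
with the range of \<^term>\<open>A\<close>, which depend continuously on the argument.\<close>

lemma sharpA_adjoint_pair:
  assumes T: "T \<in> BA J A"
  shows "adjoint_pair T (sharpA J A T)"
proof -
  have op: "is_op J T" and ran: "\<And>x. cadj J T (A x) \<in> range A"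
    using T unfolding BA_def by auto
  have bT: "bounded_linear T" and TJ: "\<And>x. T (J x) = J (T x)"
    using op unfolding is_op_def by auto
  have "\<exists>y \<in> closure (range A). A y = cadj J T (A x)" for x
  proof -
    obtain u where u: "cadj J T (A x) = A u"
      using ran by blast
    obtain p where p: "p \<in> closure (range A)" "\<And>m. m \<in> closure (range A) \<Longrightarrow> inner (u - p) m = 0"
      using orthogonal_decomposition[OF subspace_closure_range_A closed_closure] by blast
    \<comment> \<open>Projecting any solution \<open>u\<close> to \<open>p\<close> keeps it a
      solution: \<open>u - p\<close> is orthogonal to the range of the symmetric \<open>A\<close>,
      hence lies in its kernel.\<close>
    have "inner (A (u - p)) (A (u - p)) = inner (u - p) (A (A (u - p)))"
      by (rule A_symmetric)
    also have "\<dots> = 0"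
      by (intro p(2) subsetD[OF closure_subset] rangeI)
    finally have "A u = A p"
      by (simp add: linear_diff[OF linear_A])
    with p u show ?thesis by auto
  qed
  then obtain X where X: "\<And>x. X x \<in> closure (range A)" "\<And>x. A (X x) = cadj J T (A x)"
    by metis
  have XA: "inner (X x) (A w) = inner (A x) (T w)" for x w
    by (metis X(2) A_symmetric cadj_adjoint[OF op] inner_commute)
  \<comment> \<open>Pairings with the range of \<open>A\<close> determine \<open>X x\<close>, and by
    \<open>XA\<close> they involve only \<open>A\<close> and \<open>T\<close>. Linearity and
    commutation with \<open>J\<close> are read off from this.\<close>
  have X_unique: "X x = y" if "y \<in> closure (range A)" "\<And>w. inner y (A w) = inner (A x) (T w)" for x y
    by (rule eq_if_same_inner_on_range_A) (use that X XA in auto)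
  have linX: "linear X"
  proof
    show "X (x + y) = X x + X y" for x y
      by (rule X_unique) (simp_all add: X(1) XA subspace_add[OF subspace_closure_range_A]
          inner_add_left linear_add[OF linear_A])
    show "X (c *\<^sub>R x) = c *\<^sub>R X x" for c x
      by (rule X_unique) (simp_all add: X(1) XA subspace_scale[OF subspace_closure_range_A]
          linear_scale[OF linear_A])
  qed
  have bX: "bounded_linear X"
  proof (rule bounded_linear_if_closed_sublevel[OF linX])
    fix n :: nat
    have "norm (X x) \<le> real n \<longleftrightarrow> (\<forall>w. inner (A x) (T w) \<le> real n * norm (A w))" for x
    proof
      assume "norm (X x) \<le> real n"
      then show "\<forall>w. inner (A x) (T w) \<le> real n * norm (A w)"
        by (metis XA norm_cauchy_schwarz mult_right_mono norm_ge_zero order_trans)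
    qed (intro norm_le_if_inner_le_on_range_A X(1), simp_all add: XA)
    moreover have "closed {x. \<forall>w. inner (A x) (T w) \<le> real n * norm (A w)}"
      by (intro closed_Collect_all closed_Collect_le continuous_intros
          linear_continuous_on bounded_linear_A)
    ultimately show "closed {x. norm (X x) \<le> real n}"
      by simp
  qed
  have J_closure: "J y \<in> closure (range A)" if "y \<in> closure (range A)" for y
  proof -
    have "J ` closure (range A) \<subseteq> closure (J ` range A)"
      by (rule closure_bounded_linear_image_subset[OF bounded_linear_J])
    also have "\<dots> \<subseteq> closure (range A)"
      by (intro closure_mono) (auto simp flip: A_J)
    finally show ?thesis using that by blast
  qed
  have XJ: "X (J x) = J (X x)" for x
  proof (rule X_unique)
    show "inner (J (X x)) (A w) = inner (A (J x)) (T w)" for w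
      using XA[of x "J w"] by (simp add: A_J TJ inner_J_right)
  qed (simp add: J_closure X(1))
  have "sharpA J A T = X"
    unfolding sharpA_def
  proof (rule the_equality)
    show "is_op J X \<and> A \<circ> X = cadj J T \<circ> A \<and> range X \<subseteq> closure (range A)"
      using bX XJ X by (auto simp: is_op_def)
    show "Y = X" if "is_op J Y \<and> A \<circ> Y = cadj J T \<circ> A \<and> range Y \<subseteq> closure (range A)" for Y
    proof
      fix x
      have "A (Y x) = A (X x)"
        using that X(2) by (metis comp_apply)
      then show "Y x = X x"
        by (intro eq_if_same_inner_on_range_A) (use that X in \<open>auto simp flip: A_symmetric\<close>)
    qed
  qed
  moreover have "ipA (T x) y = ipA x (X y)" for x y
    by (metis XA ipA_commute ipA_def inner_commute A_symmetric)
  ultimately show ?thesis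
    using bT bX by (simp add: adjoint_pair_def)
qed

section \<open>The numerical radius bound\<close>

text \<open>The bound is the largest eigenvalue of the form with matrix \<open>((p\<^sup>2, m), (m, q\<^sup>2))\<close>.\<close>

lemma nA_add_le_eigenvalue:
  assumes u: "nA u \<le> p * nA x" and v: "nA v \<le> q * nA y" and uv: "ipA u v \<le> m * (nA x * nA y)"
    and unit: "(nA x)\<^sup>2 + (nA y)\<^sup>2 = 1"
  shows "nA (u + v) \<le> sqrt 2 / 2 * sqrt (p\<^sup>2 + q\<^sup>2 + sqrt ((p\<^sup>2 - q\<^sup>2)\<^sup>2 + 4 * m\<^sup>2))"
proof -
  define a b where "a = nA x" and "b = nA y"
  define D where "D = sqrt ((p\<^sup>2 - q\<^sup>2)\<^sup>2 + 4 * m\<^sup>2)"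
  have D2: "D\<^sup>2 = (p\<^sup>2 - q\<^sup>2)\<^sup>2 + 4 * m\<^sup>2"
    by (simp add: D_def)
  have ab: "a\<^sup>2 + b\<^sup>2 = 1"
    using unit by (simp add: a_def b_def)
  \<comment> \<open>Lagrange's identity for the vectors
    \<open>(p\<^sup>2 - q\<^sup>2, 2 * m)\<close>, of length \<open>D\<close>, and
    \<open>(a\<^sup>2 - b\<^sup>2, 2 * a * b)\<close>, of length
    \<open>a\<^sup>2 + b\<^sup>2 = 1\<close>. Dropping the second square leaves
    Cauchy-Schwarz.\<close>
  have "((p\<^sup>2 - q\<^sup>2) * (a\<^sup>2 - b\<^sup>2) + 2 * m * (2 * a * b))\<^sup>2
      + ((p\<^sup>2 - q\<^sup>2) * (2 * a * b) - 2 * m * (a\<^sup>2 - b\<^sup>2))\<^sup>2 = D\<^sup>2 * (a\<^sup>2 + b\<^sup>2)\<^sup>2"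
    unfolding D2 by algebra
  then have "((p\<^sup>2 - q\<^sup>2) * (a\<^sup>2 - b\<^sup>2) + 2 * m * (2 * a * b))\<^sup>2 \<le> D\<^sup>2"
    by (simp add: ab) (metis le_add_same_cancel1 zero_le_power2)
  then have rot: "(p\<^sup>2 - q\<^sup>2) * (a\<^sup>2 - b\<^sup>2) + 2 * m * (2 * a * b) \<le> D"
    by (rule power2_le_imp_le) (simp add: D_def)
  have "(nA (u + v))\<^sup>2 = (nA u)\<^sup>2 + (nA v)\<^sup>2 + 2 * ipA u v"
    by (simp add: nA_power2 ipA_add_left ipA_add_right ipA_commute[of v u])
  also have "\<dots> \<le> (p * a)\<^sup>2 + (q * b)\<^sup>2 + 2 * (m * (a * b))"
    unfolding a_def b_def using u v uv by (intro add_mono power_mono mult_left_mono) auto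
  also have "\<dots> = ((p\<^sup>2 + q\<^sup>2) * (a\<^sup>2 + b\<^sup>2) + ((p\<^sup>2 - q\<^sup>2) * (a\<^sup>2 - b\<^sup>2) + 2 * m * (2 * a * b))) / 2"
    by (simp add: field_simps power2_eq_square)
  also have "\<dots> \<le> (p\<^sup>2 + q\<^sup>2 + D) / 2"
    using rot by (simp add: ab)
  finally have "nA (u + v) \<le> sqrt ((p\<^sup>2 + q\<^sup>2 + D) / 2)"
    by (rule real_le_rsqrt)
  also have "\<dots> = sqrt 2 / 2 * sqrt (p\<^sup>2 + q\<^sup>2 + D)"
    by (simp add: real_sqrt_divide field_simps)
  finally show ?thesis by (simp add: D_def)
qed

lemma nA_row_le:
  assumes T: "adjoint_pair T T'" and U: "adjoint_pair U U'" and unit: "(nA x)\<^sup>2 + (nA y)\<^sup>2 = 1"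
  shows "nA (T x + U y) \<le> sqrt 2 / 2 * sqrt ((opnormA J A T)\<^sup>2 + (opnormA J A U)\<^sup>2
    + sqrt (((opnormA J A T)\<^sup>2 - (opnormA J A U)\<^sup>2)\<^sup>2 + 4 * (opnormA J A (T' \<circ> U))\<^sup>2))"
proof (rule nA_add_le_eigenvalue[OF nA_le_opnormA[OF T] nA_le_opnormA[OF U] _ unit])
  have "ipA (T x) (U y) = ipA x ((T' \<circ> U) y)"
    using T by (simp add: adjoint_pair_def)
  also have "\<dots> \<le> nA x * nA ((T' \<circ> U) y)"
    using ipA_Cauchy_Schwarz abs_le_D1 by blast
  also have "\<dots> \<le> nA x * (opnormA J A (T' \<circ> U) * nA y)"
    by (intro mult_left_mono nA_le_opnormA[OF adjoint_pair_comp[OF adjoint_pair_sym[OF T] U]]) simp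
  finally show "ipA (T x) (U y) \<le> opnormA J A (T' \<circ> U) * (nA x * nA y)"
    by (simp add: algebra_simps)
qed

text \<open>The same eigenvalue bound for adjoints: moving \<open>T'\<close> across the form turns
  it into \<open>T\<close>, so the off-diagonal entry is \<open>T \<circ> U'\<close>.\<close>

lemma nA_adjoint_row_le:
  assumes T: "adjoint_pair T T'" and U: "adjoint_pair U U'" and unit: "(nA x)\<^sup>2 + (nA y)\<^sup>2 = 1"
  shows "nA (T' x + U' y) \<le> sqrt 2 / 2 * sqrt ((opnormA J A T)\<^sup>2 + (opnormA J A U)\<^sup>2
    + sqrt (((opnormA J A T)\<^sup>2 - (opnormA J A U)\<^sup>2)\<^sup>2 + 4 * (opnormA J A (T \<circ> U'))\<^sup>2))"
proof (rule nA_add_le_eigenvalue[OF nA_adjoint_le_opnormA[OF T] nA_adjoint_le_opnormA[OF U] _ unit])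
  have "ipA (T' x) (U' y) = ipA x ((T \<circ> U') y)"
    using adjoint_pair_sym[OF T] by (simp add: adjoint_pair_def)
  also have "\<dots> \<le> nA x * nA ((T \<circ> U') y)"
    using ipA_Cauchy_Schwarz abs_le_D1 by blast
  also have "\<dots> \<le> nA x * (opnormA J A (T \<circ> U') * nA y)"
    by (intro mult_left_mono nA_le_opnormA[OF adjoint_pair_comp[OF T adjoint_pair_sym[OF U]]]) simp
  finally show "ipA (T' x) (U' y) \<le> opnormA J A (T \<circ> U') * (nA x * nA y)"
    by (simp add: algebra_simps)
qed

section \<open>Passing between the block form and its components\<close>

lemma cinnerA_add_left: "cinnerA J A (u + v) y = cinnerA J A u y + cinnerA J A v y"
  by (simp add: cinnerA_eq ipA_add_left complex_eq_iff)

lemma ipA_J_right: "ipA x (J y) = - ipA (J x) y"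
  by (simp add: ipA_def A_J inner_J_right)

lemma cinnerA_cnj: "cinnerA J A x y = cnj (cinnerA J A y x)"
  by (simp add: cinnerA_eq complex_eq_iff ipA_commute[of y x] ipA_J_right ipA_commute[of "J y" x])

text \<open>\<open>ipA x (A x)\<close> is the squared norm of \<open>A x\<close>, so Cauchy-Schwarz
  excludes \<open>nA x = 0\<close> when \<open>A x\<close> is nonzero. This keeps the supremum in
  \<open>numradA\<close> from ranging over an empty set.\<close>

lemma exists_unit_vector:
  assumes "A \<noteq> (\<lambda>x. 0)"
  obtains x where "nA x = 1"
proof -
  obtain x where x: "A x \<noteq> 0"
    using assms by blast
  have "ipA x (A x) \<noteq> 0"
    using x by (simp add: ipA_def)
  then have "nA x \<noteq> 0"
    using ipA_Cauchy_Schwarz[of x "A x"] by auto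
  then have "nA ((1 / nA x) *\<^sub>R x) = 1"
    by (simp add: nA_scaleR)
  with that show thesis .
qed

lemma normA_blk: "normA (Jsum J) (blk A (\<lambda>x. 0) (\<lambda>x. 0) A) (x, y) = sqrt ((nA x)\<^sup>2 + (nA y)\<^sup>2)"
  by (simp add: normA_def[of "Jsum J"] cinnerA_def cinner_def blk_def nA_power2 ipA_def)

lemma cinnerA_blk:
  "cinnerA (Jsum J) (blk A (\<lambda>x. 0) (\<lambda>x. 0) A) (u, v) (x, y) = cinnerA J A u x + cinnerA J A v y"
  by (simp add: cinnerA_def cinner_def blk_def Jsum_def complex_eq_iff)

lemma cinnerA_sharpA:
  assumes T: "T \<in> BA J A"
  shows "cinnerA J A (T x) y = cnj (cinnerA J A (sharpA J A T y) x)"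
proof -
  have "J (T x) = T (J x)" for x
    using T by (simp add: BA_def is_op_def)
  then have "cinnerA J A (T x) y = cinnerA J A x (sharpA J A T y)"
    using sharpA_adjoint_pair[OF T] by (simp add: cinnerA_eq adjoint_pair_def ipA_J_right)
  then show ?thesis
    using cinnerA_cnj[of x "sharpA J A T y"] by simp
qed

text \<open>Each component of a unit vector has seminorm at most 1, so the two row bounds simply
  add; hence the two summands in \<open>\<mu>\<close> and in \<open>\<nu>\<close>.\<close>

lemma cmod_cinnerA_add_le:
  assumes unit: "(nA x)\<^sup>2 + (nA y)\<^sup>2 = 1" and u: "nA u \<le> a" and v: "nA v \<le> b"
  shows "cmod (cinnerA J A u x + cinnerA J A v y) \<le> a + b"
proof -
  have "(nA x)\<^sup>2 \<le> 1" "(nA y)\<^sup>2 \<le> 1"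
    using unit zero_le_power2[of "nA x"] zero_le_power2[of "nA y"] by linarith+
  then have xy: "nA x \<le> 1" "nA y \<le> 1"
    by (simp_all add: abs_square_le_1)
  have "cmod (cinnerA J A w z) \<le> c" if "nA w \<le> c" "nA z \<le> 1" for w z c
    using cinnerA_Cauchy_Schwarz[of w z] mult_left_mono[OF that(2) nA_nonneg[of w]] that(1) by linarith
  then show ?thesis
    using xy u v by (intro norm_triangle_mono) auto
qed

end

theorem theorem2p16:
  fixes J A P Q R S :: "'h::{real_inner, complete_space} \<Rightarrow> 'h"
  assumes J: "complex_structure J"
    and Apos: "positive_op J A" and Anz: "A \<noteq> (\<lambda>x. 0)"
    and P: "P \<in> BA J A" and Q: "Q \<in> BA J A" and R: "R \<in> BA J A" and S: "S \<in> BA J A"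
  shows "numradA (Jsum J) (blk A (\<lambda>x. 0) (\<lambda>x. 0) A) (blk P Q R S) \<le>
    min
     (sqrt 2 / 2 * sqrt ((opnormA J A P)\<^sup>2 + (opnormA J A Q)\<^sup>2
        + sqrt (((opnormA J A P)\<^sup>2 - (opnormA J A Q)\<^sup>2)\<^sup>2 + 4 * (opnormA J A (sharpA J A P \<circ> Q))\<^sup>2))
      + sqrt 2 / 2 * sqrt ((opnormA J A R)\<^sup>2 + (opnormA J A S)\<^sup>2
        + sqrt (((opnormA J A R)\<^sup>2 - (opnormA J A S)\<^sup>2)\<^sup>2 + 4 * (opnormA J A (sharpA J A S \<circ> R))\<^sup>2)))
     (sqrt 2 / 2 * sqrt ((opnormA J A P)\<^sup>2 + (opnormA J A R)\<^sup>2
        + sqrt (((opnormA J A P)\<^sup>2 - (opnormA J A R)\<^sup>2)\<^sup>2 + 4 * (opnormA J A (P \<circ> sharpA J A R))\<^sup>2))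
      + sqrt 2 / 2 * sqrt ((opnormA J A Q)\<^sup>2 + (opnormA J A S)\<^sup>2
        + sqrt (((opnormA J A Q)\<^sup>2 - (opnormA J A S)\<^sup>2)\<^sup>2 + 4 * (opnormA J A (S \<circ> sharpA J A Q))\<^sup>2)))"
proof -
  interpret semi_hilbert J A
    by unfold_locales (rule J, rule Apos)
  let ?A = "blk A (\<lambda>x. 0) (\<lambda>x. 0) A"
  note adj = sharpA_adjoint_pair[OF P] sharpA_adjoint_pair[OF Q]
    sharpA_adjoint_pair[OF R] sharpA_adjoint_pair[OF S]
  obtain x0 where "nA x0 = 1"
    using exists_unit_vector[OF Anz] .
  then have "normA (Jsum J) ?A (x0, 0) = 1"
    using nA_scaleR[of 0 x0] by (simp add: normA_blk)
  then have ne: "{z. normA (Jsum J) ?A z = 1} \<noteq> {}"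
    by blast
  show ?thesis
    unfolding numradA_def
  proof (rule cSUP_least[OF ne], clarify)
    fix x y assume "normA (Jsum J) ?A (x, y) = 1"
    then have unit: "(nA x)\<^sup>2 + (nA y)\<^sup>2 = 1" and unit': "(nA y)\<^sup>2 + (nA x)\<^sup>2 = 1"
      by (simp_all add: normA_blk add.commute)
    let ?val = "cmod (cinnerA (Jsum J) ?A (blk P Q R S (x, y)) (x, y))"
    \<comment> \<open>The second row is written with \<open>S y\<close> first and used with
      \<open>unit'\<close>, so that its off-diagonal entry becomes
      \<open>sharpA J A S \<circ> R\<close>.\<close>
    have rows: "?val = cmod (cinnerA J A (P x + Q y) x + cinnerA J A (S y + R x) y)"
    proof -
      have "blk P Q R S (x, y) = (P x + Q y, S y + R x)"
        by (simp add: blk_def add.commute)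
      then show ?thesis
        by (simp only: cinnerA_blk)
    qed
    \<comment> \<open>Up to conjugation this is the quadratic form of the adjoint block operator,
      whose rows are the adjoints of the columns of the original.\<close>
    have "cinnerA J A (P x + Q y) x + cinnerA J A (S y + R x) y
      = cnj (cinnerA J A (sharpA J A P x + sharpA J A R y) x
          + cinnerA J A (sharpA J A S y + sharpA J A Q x) y)"
      by (simp add: cinnerA_add_left cinnerA_sharpA P Q R S)
    then have cols: "?val = cmod (cinnerA J A (sharpA J A P x + sharpA J A R y) x
          + cinnerA J A (sharpA J A S y + sharpA J A Q x) y)"
      unfolding rows by (metis complex_mod_cnj)
    show "?val \<le> min
     (sqrt 2 / 2 * sqrt ((opnormA J A P)\<^sup>2 + (opnormA J A Q)\<^sup>2
        + sqrt (((opnormA J A P)\<^sup>2 - (opnormA J A Q)\<^sup>2)\<^sup>2 + 4 * (opnormA J A (sharpA J A P \<circ> Q))\<^sup>2))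
      + sqrt 2 / 2 * sqrt ((opnormA J A R)\<^sup>2 + (opnormA J A S)\<^sup>2
        + sqrt (((opnormA J A R)\<^sup>2 - (opnormA J A S)\<^sup>2)\<^sup>2 + 4 * (opnormA J A (sharpA J A S \<circ> R))\<^sup>2)))
     (sqrt 2 / 2 * sqrt ((opnormA J A P)\<^sup>2 + (opnormA J A R)\<^sup>2
        + sqrt (((opnormA J A P)\<^sup>2 - (opnormA J A R)\<^sup>2)\<^sup>2 + 4 * (opnormA J A (P \<circ> sharpA J A R))\<^sup>2))
      + sqrt 2 / 2 * sqrt ((opnormA J A Q)\<^sup>2 + (opnormA J A S)\<^sup>2
        + sqrt (((opnormA J A Q)\<^sup>2 - (opnormA J A S)\<^sup>2)\<^sup>2 + 4 * (opnormA J A (S \<circ> sharpA J A Q))\<^sup>2)))"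
      (is "_ \<le> min ?\<mu> ?\<nu>")
    proof (rule min.boundedI)
      show "?val \<le> ?\<mu>"
        unfolding rows
        \<comment> \<open>The second bound comes with \<open>S\<close> before \<open>R\<close>;
          symmetry of the sum and of the squared difference restores the order of
          \<open>\<mu>\<close>.\<close>
        using cmod_cinnerA_add_le[OF unit nA_row_le[OF adj(1,2) unit] nA_row_le[OF adj(4,3) unit']]
        by (simp add: add.commute power2_commute)
      show "?val \<le> ?\<nu>"
        unfolding cols
        using cmod_cinnerA_add_le[OF unit nA_adjoint_row_le[OF adj(1,3) unit] nA_adjoint_row_le[OF adj(4,2) unit']]
        by (simp add: add.commute power2_commute)
    qed
  qed
qed

end
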